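(* Let $n\geq 1$. Green's relations $\mathcal{L}$, $\mathcal{R}$, $\mathcal{D}$, $\mathcal{H}$ and $\mathcal{J}$ on the monoid $\mathrm{K}_n$ are trivial, that is, every equivalence class of each of these relations consists of exactly one element.
   Context: For a positive integer $n$, Kiselman's semigroup $\mathrm{K}_n$ is the monoid (with unit element $e$) given by the monoid presentation with generators $a_1,\dots,a_n$ and relations $a_i^2=a_i$ for $i=1,\dots,n$, and $a_ia_ja_i=a_ja_ia_j=a_ja_i$ for all $1\leq i<j\leq n$. *)

theory Defs
  imports "HOL-Algebra.Coset"
begin

section \<open>Monoid presentations\<close>

text \<open>
  The free monoid on \<open>X\<close> is \<open>lists X\<close> under concatenation.  Given a set \<open>E\<close> of pairs of words
  (the defining relations), \<open>pres_cong X E\<close> is the least congruence on \<open>lists X\<close> containing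
  \<open>E \<inter> (lists X \<times> lists X)\<close>.
\<close>

inductive_set pres_cong :: "'a set \<Rightarrow> ('a list \<times> 'a list) set \<Rightarrow> ('a list \<times> 'a list) set"
  for X :: "'a set" and E :: "('a list \<times> 'a list) set" where
  base: "(u, v) \<in> E \<Longrightarrow> u \<in> lists X \<Longrightarrow> v \<in> lists X \<Longrightarrow> (u, v) \<in> pres_cong X E"
| refl: "u \<in> lists X \<Longrightarrow> (u, u) \<in> pres_cong X E"
| sym: "(u, v) \<in> pres_cong X E \<Longrightarrow> (v, u) \<in> pres_cong X E"
| trans: "(u, v) \<in> pres_cong X E \<Longrightarrow> (v, w) \<in> pres_cong X E \<Longrightarrow> (u, w) \<in> pres_cong X E"
| mult: "(u, v) \<in> pres_cong X E \<Longrightarrow> (u', v') \<in> pres_cong X E \<Longrightarrow> (u @ u', v @ v') \<in> pres_cong X E"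

definition presented_monoid :: "'a set \<Rightarrow> ('a list \<times> 'a list) set \<Rightarrow> 'a list set monoid" where
  "presented_monoid X E =
    \<lparr> carrier = lists X // pres_cong X E,
      mult = (\<lambda>A B. \<Union>u\<in>A. \<Union>v\<in>B. pres_cong X E `` {u @ v}),
      one = pres_cong X E `` {[]} \<rparr>"

lemma pres_cong_in_lists:
  "(u, v) \<in> pres_cong X E \<Longrightarrow> u \<in> lists X \<and> v \<in> lists X"
  by (induction rule: pres_cong.induct) auto

lemma equiv_pres_cong: "equiv (lists X) (pres_cong X E)"
proof (rule equivI)
  show "pres_cong X E \<subseteq> lists X \<times> lists X"
    using pres_cong_in_lists by fast
  show "refl_on (lists X) (pres_cong X E)"
    by (auto intro!: refl_onI pres_cong.refl)
  show "sym (pres_cong X E)"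
    by (auto intro: symI pres_cong.sym)
  show "trans (pres_cong X E)"
    by (auto intro: transI pres_cong.trans)
qed

lemma presented_monoid_mult_class:
  assumes "u \<in> lists X" "v \<in> lists X"
  shows "pres_cong X E `` {u} \<otimes>\<^bsub>presented_monoid X E\<^esub> pres_cong X E `` {v}
    = pres_cong X E `` {u @ v}"
proof -
  have eq: "pres_cong X E `` {u' @ v'} = pres_cong X E `` {u @ v}"
    if "u' \<in> pres_cong X E `` {u}" "v' \<in> pres_cong X E `` {v}" for u' v'
    using that equiv_class_eq[OF equiv_pres_cong pres_cong.mult[of u u' X E v v']] by simp
  have "u \<in> pres_cong X E `` {u}" "v \<in> pres_cong X E `` {v}"
    using assms by (auto intro: pres_cong.refl)
  then have "(\<Union>u'\<in>pres_cong X E `` {u}. \<Union>v'\<in>pres_cong X E `` {v}. pres_cong X E `` {u' @ v'})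
    = pres_cong X E `` {u @ v}"
    using eq by blast
  then show ?thesis
    by (simp add: presented_monoid_def)
qed

lemma monoid_presented_monoid: "monoid (presented_monoid X E)"
proof -
  let ?M = "presented_monoid X E"
  have carr: "\<exists>u \<in> lists X. A = pres_cong X E `` {u}" if "A \<in> carrier ?M" for A
    using that by (auto simp: presented_monoid_def quotient_def)
  have cls: "pres_cong X E `` {u} \<in> carrier ?M" if "u \<in> lists X" for u
    using that by (auto simp: presented_monoid_def quotient_def)
  have one: "\<one>\<^bsub>?M\<^esub> = pres_cong X E `` {[]}"
    by (simp add: presented_monoid_def)
  have app: "u @ v \<in> lists X" if "u \<in> lists X" "v \<in> lists X" for u v :: "'a list"
    using that by simp
  have nil: "[] \<in> lists X" by simp
  show ?thesis
  proof
    fix A B assume "A \<in> carrier ?M" "B \<in> carrier ?M"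
    then obtain u v where "u \<in> lists X" "v \<in> lists X"
      "A = pres_cong X E `` {u}" "B = pres_cong X E `` {v}"
      using carr by blast
    then show "A \<otimes>\<^bsub>?M\<^esub> B \<in> carrier ?M"
      using cls[OF app] by (simp only: presented_monoid_mult_class)
  next
    fix A B C assume "A \<in> carrier ?M" "B \<in> carrier ?M" "C \<in> carrier ?M"
    then obtain u v w where "u \<in> lists X" "v \<in> lists X" "w \<in> lists X"
      "A = pres_cong X E `` {u}" "B = pres_cong X E `` {v}" "C = pres_cong X E `` {w}"
      using carr by meson
    then show "A \<otimes>\<^bsub>?M\<^esub> B \<otimes>\<^bsub>?M\<^esub> C = A \<otimes>\<^bsub>?M\<^esub> (B \<otimes>\<^bsub>?M\<^esub> C)"
      by (simp only: presented_monoid_mult_class app append_assoc)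
  next
    show "\<one>\<^bsub>?M\<^esub> \<in> carrier ?M" using one cls[OF nil] by (simp only:)
  next
    fix A assume "A \<in> carrier ?M"
    then obtain u where "u \<in> lists X" "A = pres_cong X E `` {u}"
      using carr by blast
    then show "\<one>\<^bsub>?M\<^esub> \<otimes>\<^bsub>?M\<^esub> A = A" "A \<otimes>\<^bsub>?M\<^esub> \<one>\<^bsub>?M\<^esub> = A"
      by (simp_all only: one nil presented_monoid_mult_class append_Nil append_Nil2)
  qed
qed

section \<open>Kiselman's semigroup\<close>

text \<open>The generator \<open>a\<^sub>i\<close> is represented by the letter \<open>i\<close>, for \<open>1 \<le> i \<le> n\<close>.\<close>

definition kiselman_rels :: "nat \<Rightarrow> (nat list \<times> nat list) set" where
  "kiselman_rels n =
    {([i, i], [i]) | i. i \<in> {1..n}}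
    \<union> {([i, j, i], [j, i]) | i j. 1 \<le> i \<and> i < j \<and> j \<le> n}
    \<union> {([j, i, j], [j, i]) | i j. 1 \<le> i \<and> i < j \<and> j \<le> n}"

definition Kiselman :: "nat \<Rightarrow> nat list set monoid" where
  "Kiselman n = presented_monoid {1..n} (kiselman_rels n)"

lemma monoid_Kiselman: "monoid (Kiselman n)"
  by (simp add: Kiselman_def monoid_presented_monoid)

section \<open>Green's relations\<close>

text \<open>
  Since \<open>M\<close> has a unit, the principal left, right and two-sided ideals generated by \<open>a\<close> are
  \<open>M a\<close>, \<open>a M\<close> and \<open>M a M\<close>; these are written with the coset operations, whose definitions
  make sense in any monoid.
\<close>

definition green_L :: "('a, 'b) monoid_scheme \<Rightarrow> ('a \<times> 'a) set" where
  "green_L M = {(a, b) \<in> carrier M \<times> carrier M. carrier M #>\<^bsub>M\<^esub> a = carrier M #>\<^bsub>M\<^esub> b}"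

definition green_R :: "('a, 'b) monoid_scheme \<Rightarrow> ('a \<times> 'a) set" where
  "green_R M = {(a, b) \<in> carrier M \<times> carrier M. a <#\<^bsub>M\<^esub> carrier M = b <#\<^bsub>M\<^esub> carrier M}"

definition green_J :: "('a, 'b) monoid_scheme \<Rightarrow> ('a \<times> 'a) set" where
  "green_J M = {(a, b) \<in> carrier M \<times> carrier M.
     (carrier M #>\<^bsub>M\<^esub> a) <#>\<^bsub>M\<^esub> carrier M = (carrier M #>\<^bsub>M\<^esub> b) <#>\<^bsub>M\<^esub> carrier M}"

definition green_H :: "('a, 'b) monoid_scheme \<Rightarrow> ('a \<times> 'a) set" where
  "green_H M = green_L M \<inter> green_R M"

text \<open>
  \<open>\<D>\<close> is the join of \<open>\<L>\<close> and \<open>\<R>\<close> in the lattice of equivalence relations.  As \<open>\<L>\<close> and \<open>\<R>\<close>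
  commute, it coincides with their composition; see \<open>green_D_eq_comp\<close> below.
\<close>

definition green_D :: "('a, 'b) monoid_scheme \<Rightarrow> ('a \<times> 'a) set" where
  "green_D M = (green_L M \<union> green_R M)\<^sup>+"

lemma equiv_green_L: "equiv (carrier M) (green_L M)"
  by (rule equivI) (auto simp: green_L_def intro!: refl_onI symI transI)

lemma equiv_green_R: "equiv (carrier M) (green_R M)"
  by (rule equivI) (auto simp: green_R_def intro!: refl_onI symI transI)

lemma equiv_green_J: "equiv (carrier M) (green_J M)"
  by (rule equivI) (auto simp: green_J_def intro!: refl_onI symI transI)

lemma equiv_green_H: "equiv (carrier M) (green_H M)"
  by (rule equivI) (auto simp: green_H_def green_L_def green_R_def intro!: refl_onI symI transI)

lemma equiv_green_D: "equiv (carrier M) (green_D M)"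
proof (rule equivI)
  have "green_L M \<union> green_R M \<subseteq> carrier M \<times> carrier M"
    by (auto simp: green_L_def green_R_def)
  then show "green_D M \<subseteq> carrier M \<times> carrier M"
    unfolding green_D_def by (rule trancl_subset_Sigma)
  show "refl_on (carrier M) (green_D M)"
    by (auto simp: green_D_def green_L_def intro!: refl_onI r_into_trancl)
  show "sym (green_D M)"
    unfolding green_D_def
    by (rule sym_trancl) (auto simp: green_L_def green_R_def intro!: symI)
  show "trans (green_D M)"
    by (simp add: green_D_def)
qed

lemma (in monoid) green_L_iff:
  assumes "a \<in> carrier G" "b \<in> carrier G"
  shows "(a, b) \<in> green_L G \<longleftrightarrow>
    (\<exists>s\<in>carrier G. a = s \<otimes> b) \<and> (\<exists>t\<in>carrier G. b = t \<otimes> a)"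
proof -
  have sub: "carrier G #> x \<subseteq> carrier G #> y \<longleftrightarrow> (\<exists>s\<in>carrier G. x = s \<otimes> y)"
    if "x \<in> carrier G" "y \<in> carrier G" for x y
  proof
    assume "carrier G #> x \<subseteq> carrier G #> y"
    moreover have "x \<in> carrier G #> x" using that l_one[OF that(1)] unfolding r_coset_def by blast
    ultimately show "\<exists>s\<in>carrier G. x = s \<otimes> y" by (auto simp: r_coset_def)
  next
    assume "\<exists>s\<in>carrier G. x = s \<otimes> y"
    then obtain s where s: "s \<in> carrier G" "x = s \<otimes> y" by blast
    have "h \<otimes> x \<in> carrier G #> y" if "h \<in> carrier G" for h
    proof -
      have "h \<otimes> x = (h \<otimes> s) \<otimes> y"
        using s that \<open>y \<in> carrier G\<close> by (simp add: m_assoc)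
      moreover have "h \<otimes> s \<in> carrier G" using s that by simp
      ultimately show ?thesis unfolding r_coset_def by blast
    qed
    then show "carrier G #> x \<subseteq> carrier G #> y"
      by (subst r_coset_def) blast
  qed
  have "(a, b) \<in> green_L G \<longleftrightarrow> carrier G #> a \<subseteq> carrier G #> b \<and> carrier G #> b \<subseteq> carrier G #> a"
    using assms unfolding green_L_def by blast
  then show ?thesis
    by (simp only: sub[OF assms] sub[OF assms(2,1)])
qed

lemma (in monoid) green_R_iff:
  assumes "a \<in> carrier G" "b \<in> carrier G"
  shows "(a, b) \<in> green_R G \<longleftrightarrow>
    (\<exists>s\<in>carrier G. a = b \<otimes> s) \<and> (\<exists>t\<in>carrier G. b = a \<otimes> t)"
proof -
  have sub: "x <# carrier G \<subseteq> y <# carrier G \<longleftrightarrow> (\<exists>s\<in>carrier G. x = y \<otimes> s)"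
    if "x \<in> carrier G" "y \<in> carrier G" for x y
  proof
    assume "x <# carrier G \<subseteq> y <# carrier G"
    moreover have "x \<in> x <# carrier G" using that r_one[OF that(1)] unfolding l_coset_def by blast
    ultimately show "\<exists>s\<in>carrier G. x = y \<otimes> s" by (auto simp: l_coset_def)
  next
    assume "\<exists>s\<in>carrier G. x = y \<otimes> s"
    then obtain s where s: "s \<in> carrier G" "x = y \<otimes> s" by blast
    have "x \<otimes> h \<in> y <# carrier G" if "h \<in> carrier G" for h
    proof -
      have "x \<otimes> h = y \<otimes> (s \<otimes> h)"
        using s that \<open>y \<in> carrier G\<close> by (simp add: m_assoc)
      moreover have "s \<otimes> h \<in> carrier G" using s that by simp
      ultimately show ?thesis unfolding l_coset_def by blast
    qed
    then show "x <# carrier G \<subseteq> y <# carrier G"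
      by (subst l_coset_def) blast
  qed
  have "(a, b) \<in> green_R G \<longleftrightarrow> a <# carrier G \<subseteq> b <# carrier G \<and> b <# carrier G \<subseteq> a <# carrier G"
    using assms unfolding green_R_def by blast
  then show ?thesis
    by (simp only: sub[OF assms] sub[OF assms(2,1)])
qed

lemma (in monoid) green_RL_subset_LR: "green_R G O green_L G \<subseteq> green_L G O green_R G"
proof clarify
  fix a b c assume ab: "(a, b) \<in> green_R G" and bc: "(b, c) \<in> green_L G"
  then have carr: "a \<in> carrier G" "b \<in> carrier G" "c \<in> carrier G"
    by (auto simp: green_R_def green_L_def)
  obtain s s' where s: "s \<in> carrier G" "s' \<in> carrier G" "a = b \<otimes> s" "b = a \<otimes> s'"
    using ab unfolding green_R_iff[OF carr(1,2)] by (elim conjE bexE) (rule that)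
  obtain t t' where t: "t \<in> carrier G" "t' \<in> carrier G" "b = t \<otimes> c" "c = t' \<otimes> b"
    using bc unfolding green_L_iff[OF carr(2,3)] by (elim conjE bexE) (rule that)
  define d where "d = c \<otimes> s"
  have d: "d \<in> carrier G" unfolding d_def using carr(3) s(1) by (rule m_closed)
  have "t \<otimes> d = (t \<otimes> c) \<otimes> s" using s(1) t(1) carr by (simp only: d_def m_assoc)
  then have a: "a = t \<otimes> d" by (simp only: t(3)[symmetric] s(3)[symmetric])
  have "d = t' \<otimes> (b \<otimes> s)" unfolding d_def by (subst t(4)) (use s(1) t(2) carr in \<open>simp only: m_assoc\<close>)
  then have d': "d = t' \<otimes> a" by (simp only: s(3)[symmetric])
  have "d \<otimes> s' = t' \<otimes> (a \<otimes> s')" unfolding d' using s(2) t(2) carr by (simp only: m_assoc)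
  then have c: "c = d \<otimes> s'" by (simp only: s(4)[symmetric] t(4)[symmetric])
  have "(a, d) \<in> green_L G"
    unfolding green_L_iff[OF carr(1) d] using a d' t(1,2) by (intro conjI bexI)
  moreover have "(d, c) \<in> green_R G"
    unfolding green_R_iff[OF d carr(3)] using c d_def s(1,2) by (intro conjI bexI)
  ultimately show "(a, c) \<in> green_L G O green_R G" by blast
qed

lemma (in monoid) green_D_eq_comp: "green_D G = green_L G O green_R G"
proof
  have LL: "(a, c) \<in> green_L G" if "(a, b) \<in> green_L G" "(b, c) \<in> green_L G" for a b c
    using that by (auto simp: green_L_def)
  have RR: "(a, c) \<in> green_R G" if "(a, b) \<in> green_R G" "(b, c) \<in> green_R G" for a b c
    using that by (auto simp: green_R_def)
  have reflL: "(a, a) \<in> green_L G" if "(a, b) \<in> green_R G" for a b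
    using that by (auto simp: green_L_def green_R_def)
  have reflR: "(b, b) \<in> green_R G" if "(a, b) \<in> green_L G" for a b
    using that by (auto simp: green_L_def green_R_def)
  show "green_D G \<subseteq> green_L G O green_R G"
    unfolding green_D_def
  proof clarify
    fix a b assume "(a, b) \<in> (green_L G \<union> green_R G)\<^sup>+"
    then show "(a, b) \<in> green_L G O green_R G"
    proof (induction rule: trancl_induct)
      case (base y)
      then show ?case using reflL reflR by blast
    next
      case (step y z)
      then obtain w where w: "(a, w) \<in> green_L G" "(w, y) \<in> green_R G" by blast
      show ?case
      proof (cases "(y, z) \<in> green_R G")
        case True
        then show ?thesis using w RR by blast
      next
        case False
        then have "(y, z) \<in> green_L G" using step by blast
        then have "(w, z) \<in> green_L G O green_R G" using w green_RL_subset_LR by blast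
        then show ?thesis using w LL by blast
      qed
    qed
  qed
  show "green_L G O green_R G \<subseteq> green_D G"
    unfolding green_D_def by (auto intro: trancl_into_trancl)
qed

end

theory Submission
  imports Defs
begin

text \<open>
  Two \<open>\<J>\<close>-related elements satisfy \<open>a = s b t\<close> and \<open>b = s' a t'\<close>, hence \<open>a = p\<^sup>k a q\<^sup>k\<close> with
  \<open>p = s s'\<close>, \<open>q = t' t\<close>, for every \<open>k\<close>.  The power \<open>p\<^sup>n\<close> is a zero of the submonoid generated by
  the letters of \<open>p\<close>, so \<open>s'\<close> is absorbed by \<open>p\<^sup>n\<close> and \<open>t'\<close> by \<open>q\<^sup>n\<close>, and \<open>b = a\<close>.  To see that
  \<open>p\<^sup>n\<close> absorbs its letters on the right, one shows inductively that \<open>p\<^sup>k\<close> absorbs those letters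
  that are greater than \<open>n - k\<close>; on the left one uses the anti-automorphism that sends \<open>a\<^sub>i\<close> to \<open>a\<^bsub>n+1-i\<^esub>\<close>.
\<close>

section \<open>Absorption in Kiselman's semigroup\<close>

context
  fixes n :: nat
  notes One_nat_def [simp del]
begin

section \<open>The defining congruence on words\<close>

abbreviation words :: "nat list set" where
  "words \<equiv> lists {1..n}"

definition keq :: "nat list \<Rightarrow> nat list \<Rightarrow> bool" (infix "\<approx>" 50) where
  "u \<approx> v \<longleftrightarrow> (u, v) \<in> pres_cong {1..n} (kiselman_rels n)"

lemma keq_refl: "u \<in> words \<Longrightarrow> u \<approx> u"
  by (simp add: keq_def pres_cong.refl)

lemma keq_sym: "u \<approx> v \<Longrightarrow> v \<approx> u"
  by (simp add: keq_def pres_cong.sym)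

lemma keq_trans [trans]: "u \<approx> v \<Longrightarrow> v \<approx> w \<Longrightarrow> u \<approx> w"
  unfolding keq_def by (rule pres_cong.trans)

lemma keq_append: "u \<approx> v \<Longrightarrow> u' \<approx> v' \<Longrightarrow> u @ u' \<approx> v @ v'"
  by (simp add: keq_def pres_cong.mult)

lemma keq_words: "u \<approx> v \<Longrightarrow> u \<in> words \<and> v \<in> words"
  unfolding keq_def by (rule pres_cong_in_lists)

lemma keq_context: "u \<approx> v \<Longrightarrow> x \<in> words \<Longrightarrow> y \<in> words \<Longrightarrow> x @ u @ y \<approx> x @ v @ y"
  by (intro keq_append keq_refl)

lemma keq_base: "(u, v) \<in> kiselman_rels n \<Longrightarrow> u \<approx> v"
  unfolding keq_def by (rule pres_cong.base) (auto simp: kiselman_rels_def)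

section \<open>Cancelling repeated letters\<close>

lemma keq_absorb:
  assumes "1 \<le> x" "x \<le> y" "y \<le> n"
  shows "[y, x, y] \<approx> [y, x]"
proof (cases "x = y")
  case True
  have "[x, x] \<approx> [x]"
    using assms by (intro keq_base) (auto simp: kiselman_rels_def)
  from keq_append[OF this keq_refl[of "[x]"]] show ?thesis
    using True assms by simp
next
  case False
  then show ?thesis
    using assms by (intro keq_base) (auto simp: kiselman_rels_def)
qed

text \<open>Induction on the last letter \<open>x\<close>: the induction hypothesis, read backwards,
  inserts a \<open>y\<close> just before \<open>x\<close>; \<open>keq_absorb\<close> then deletes
  the \<open>y\<close> after \<open>x\<close>, and the inserted copy is removed again.\<close>

lemma keq_absorb_word:
  assumes "w \<in> words" "\<forall>x \<in> set w. x \<le> y" "1 \<le> y" "y \<le> n"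
  shows "y # w @ [y] \<approx> y # w"
  using assms
proof (induction w rule: rev_induct)
  case Nil
  then show ?case
    by (auto intro!: keq_base simp: kiselman_rels_def)
next
  case (snoc x w)
  then have IH: "y # w @ [y] \<approx> y # w" and [simp]: "w \<in> words" "[y] \<in> words" "[x] \<in> words"
    and x: "1 \<le> x" "x \<le> y"
    by auto
  have "y # w @ [x, y] \<approx> y # w @ [y, x, y]"
    using keq_sym[OF keq_append[OF IH keq_refl[of "[x, y]"]]] snoc.prems by simp
  also have "\<dots> \<approx> y # w @ [y, x]"
    using keq_append[OF keq_refl[of "y # w"] keq_absorb[OF x]] snoc.prems by simp
  also have "\<dots> \<approx> y # w @ [x]"
    using keq_append[OF IH keq_refl[OF \<open>[x] \<in> words\<close>]] by simp
  finally show ?case by simp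
qed

text \<open>Letters are treated from left to right. When a letter \<open>y > m\<close> is reached,
  everything between it and \<open>q\<close> is already at most \<open>m\<close>. Since
  \<open>q\<close> absorbs \<open>y\<close>, a copy of \<open>y\<close> may be inserted right after
  \<open>q\<close>; this copy swallows the later one by \<open>keq_absorb_word\<close> and is then
  swallowed by \<open>q\<close>.\<close>

lemma keq_filter:
  assumes q: "q \<in> words" and "u \<in> words"
    and absorb: "\<forall>y \<in> set u. m < y \<longrightarrow> q @ [y] \<approx> q"
  shows "q @ u \<approx> q @ filter (\<lambda>x. x \<le> m) u"
  using assms(2,3)
proof (induction u rule: rev_induct)
  case Nil
  then show ?case using q by (simp add: keq_refl)
next
  case (snoc y u)
  let ?u = "filter (\<lambda>x. x \<le> m) u"
  have y: "1 \<le> y" "y \<le> n" "[y] \<in> words" and u: "u \<in> words" "?u \<in> words"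
    using snoc.prems by auto
  have IH: "q @ u @ [y] \<approx> q @ ?u @ [y]"
    using keq_append[OF snoc.IH keq_refl[OF y(3)]] snoc.prems by simp
  show ?case
  proof (cases "y \<le> m")
    case True
    then show ?thesis using IH by simp
  next
    case False
    then have qy: "q @ [y] \<approx> q" using snoc.prems by simp
    have "q @ ?u @ [y] \<approx> q @ y # ?u @ [y]"
      using keq_sym[OF keq_append[OF qy keq_refl[of "?u @ [y]"]]] u y by simp
    also have "\<dots> \<approx> q @ y # ?u"
      using False u y by (intro keq_append keq_refl keq_absorb_word q) auto
    also have "\<dots> \<approx> q @ ?u"
      using keq_append[OF qy keq_refl[OF u(2)]] by simp
    finally show ?thesis using keq_trans[OF IH] False by simp
  qed
qed

section \<open>Powers of a word absorb its letters\<close>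

definition pow_word :: "nat list \<Rightarrow> nat \<Rightarrow> nat list" where
  "pow_word p k = concat (replicate k p)"

lemma pow_word_0 [simp]: "pow_word p 0 = []"
  by (simp add: pow_word_def)

lemma pow_word_Suc: "pow_word p (Suc k) = p @ pow_word p k"
  by (simp add: pow_word_def)

lemma pow_word_Suc': "pow_word p (Suc k) = pow_word p k @ p"
  by (induction k) (simp_all add: pow_word_Suc)

lemma pow_word_words: "p \<in> words \<Longrightarrow> pow_word p k \<in> words"
  by (induction k) (auto simp: pow_word_Suc)

text \<open>Each further factor \<open>p\<close> makes one more letter value absorbable. By the
  induction hypothesis \<open>p^k\<close> absorbs the letters of \<open>p\<close> above
  \<open>m = n - k\<close>, so \<open>keq_filter\<close> removes them from whatever follows
  \<open>p^k\<close>. The only new value is \<open>m\<close> itself, now the largest that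
  survives.\<close>

lemma pow_word_absorb_above:
  assumes p: "p \<in> words" and "k \<le> n" "y \<in> set p" "n - k < y"
  shows "pow_word p k @ [y] \<approx> pow_word p k"
  using assms(2-)
proof (induction k arbitrary: y)
  case 0
  then show ?case using p by auto
next
  case (Suc k)
  define m where "m = n - k"
  define q where "q = pow_word p k"
  let ?f = "filter (\<lambda>x. x \<le> m)"
  have q: "q \<in> words" using p by (simp add: q_def pow_word_words)
  have reduce: "q @ u \<approx> q @ ?f u" if "set u \<subseteq> set p" for u
    using that p Suc.IH Suc.prems(1) by (intro keq_filter q) (auto simp: q_def m_def)
  have y: "1 \<le> y" "y \<le> n" "m \<le> y" using Suc.prems p by (auto simp: m_def)
  have "?f (p @ [y]) \<approx> ?f p"
  proof (cases "y = m")
    case True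
    \<comment> \<open>The appended \<open>y\<close> already occurs in the filtered \<open>p\<close>,
      and no letter there exceeds it, so that occurrence absorbs it.\<close>
    then have "y \<in> set (?f p)" using Suc.prems by simp
    then obtain u v where uv: "?f p = u @ y # v" by (meson split_list)
    have "set (u @ y # v) \<subseteq> set p \<inter> {..m}" unfolding uv[symmetric] by auto
    then have "u \<in> words" "v \<in> words" "\<forall>x \<in> set v. x \<le> y"
      using p True by auto
    then show ?thesis
      using uv True keq_append[OF keq_refl[of u] keq_absorb_word[of v y]] y by simp
  next
    case False
    \<comment> \<open>Here \<open>y > m\<close>, so the filter drops the appended letter and both
      sides are the same word.\<close>
    then show ?thesis using y p by (auto intro!: keq_refl)
  qed
  then have "q @ ?f (p @ [y]) \<approx> q @ ?f p"
    by (intro keq_append keq_refl q)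
  with reduce[of "p @ [y]"] have "q @ p @ [y] \<approx> q @ ?f p"
    using Suc.prems by (auto intro: keq_trans)
  also have "\<dots> \<approx> q @ p"
    using reduce[of p] by (simp add: keq_sym)
  finally show ?case by (simp add: pow_word_Suc' q_def)
qed

lemma pow_word_absorb_right:
  assumes "p \<in> words" "y \<in> set p"
  shows "pow_word p n @ [y] \<approx> pow_word p n"
  using assms by (intro pow_word_absorb_above) auto

section \<open>Left-right duality\<close>

definition dual :: "nat list \<Rightarrow> nat list" where
  "dual u = rev (map (\<lambda>i. n + 1 - i) u)"

lemma dual_append: "dual (u @ v) = dual v @ dual u"
  by (simp add: dual_def)

lemma dual_words: "u \<in> words \<Longrightarrow> dual u \<in> words"
  by (auto simp: dual_def in_lists_conv_set)

text \<open>Subtraction truncates at 0, so undoing \<open>dual\<close> relies on the letters not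
  exceeding \<open>n + 1\<close>.\<close>

lemma dual_dual: "u \<in> words \<Longrightarrow> dual (dual u) = u"
  by (auto simp: dual_def rev_map in_lists_conv_set intro!: map_idI)

text \<open>The words \<open>[i, j, i]\<close> and \<open>[j, i, j]\<close> are palindromes, and
  \<open>dual\<close> exchanges the roles of the smaller and the larger letter, so it swaps these
  two families of relations. On the right side \<open>[j, i]\<close> the reversal restores the order
  with the larger letter first.\<close>

lemma keq_dual: "u \<approx> v \<Longrightarrow> dual u \<approx> dual v"
  unfolding keq_def
proof (induction rule: pres_cong.induct)
  case (base u v)
  then have "(dual u, dual v) \<in> kiselman_rels n"
    unfolding kiselman_rels_def dual_def by auto
  then show ?case
    using base by (intro pres_cong.base dual_words)
next
  case (refl u)
  then show ?case by (intro pres_cong.refl dual_words)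
qed (auto simp: dual_append intro: pres_cong.intros)

lemma dual_pow_word: "dual (pow_word p k) = pow_word (dual p) k"
  by (induction k) (simp_all add: pow_word_Suc dual_append flip: pow_word_Suc', simp add: dual_def)

lemma pow_word_absorb_left:
  assumes p: "p \<in> words" and "y \<in> set p"
  shows "y # pow_word p n \<approx> pow_word p n"
proof -
  let ?y = "n + 1 - y"
  have y: "[y] \<in> words" using assms by auto
  have "pow_word (dual p) n @ [?y] \<approx> pow_word (dual p) n"
    using assms by (intro pow_word_absorb_right dual_words) (auto simp: dual_def)
  then have "dual ([y] @ pow_word p n) \<approx> dual (pow_word p n)"
    unfolding dual_append dual_pow_word by (simp add: dual_def)
  \<comment> \<open>A second application of \<open>dual\<close> returns to the original
    words.\<close>
  then show ?thesis
    using keq_dual[of "dual ([y] @ pow_word p n)" "dual (pow_word p n)"] y p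
    by (simp add: dual_dual pow_word_words)
qed

lemma pow_word_absorb_word_right:
  assumes p: "p \<in> words" and "set u \<subseteq> set p"
  shows "pow_word p n @ u \<approx> pow_word p n"
  using assms(2)
proof (induction u)
  case Nil
  then show ?case using p by (simp add: keq_refl pow_word_words)
next
  case (Cons y u)
  then have u: "u \<in> words" using p by auto
  have "pow_word p n @ y # u \<approx> pow_word p n @ u"
    using keq_append[OF pow_word_absorb_right[OF p] keq_refl[OF u], of y] Cons.prems by simp
  with Cons show ?case by (auto intro: keq_trans)
qed

lemma pow_word_absorb_word_left:
  assumes p: "p \<in> words" and "set u \<subseteq> set p"
  shows "u @ pow_word p n \<approx> pow_word p n"
  using assms(2)
proof (induction u)
  case Nil
  then show ?case using p by (simp add: keq_refl pow_word_words)
next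
  case (Cons y u)
  then have y: "[y] \<in> words" using p by auto
  have "y # u @ pow_word p n \<approx> y # pow_word p n"
    using keq_append[OF keq_refl[OF y] Cons.IH] Cons.prems by simp
  also have "\<dots> \<approx> pow_word p n"
    using pow_word_absorb_left[OF p] Cons.prems by simp
  finally show ?case by simp
qed

section \<open>Words that are factors of each other\<close>

lemma keq_pow_sandwich:
  assumes "u \<approx> p @ u @ q" "p \<in> words" "q \<in> words"
  shows "u \<approx> pow_word p k @ u @ pow_word q k"
proof (induction k)
  case 0
  then show ?case using keq_words[OF assms(1)] by (simp add: keq_refl)
next
  case (Suc k)
  have "pow_word p k @ u @ pow_word q k \<approx> pow_word p k @ (p @ u @ q) @ pow_word q k"
    using assms by (intro keq_context pow_word_words)
  from keq_trans[OF Suc this] show ?case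
    by (simp add: pow_word_Suc' flip: pow_word_Suc)
qed

lemma keq_mutual_factors:
  assumes uv: "u \<approx> s @ v @ t" and vu: "v \<approx> s' @ u @ t'"
    and words: "s \<in> words" "t \<in> words" "s' \<in> words" "t' \<in> words"
  shows "u \<approx> v"
proof -
  define p q where "p = s @ s'" and "q = t' @ t"
  let ?P = "pow_word p n" and ?Q = "pow_word q n"
  have pq: "p \<in> words" "q \<in> words" using words by (auto simp: p_def q_def)
  have u: "u \<in> words" using keq_words[OF uv] by simp
  have "u \<approx> p @ u @ q"
    using keq_trans[OF uv keq_context[OF vu words(1,2)]] by (simp add: p_def q_def)
  from keq_pow_sandwich[OF this pq] have sandwich: "u \<approx> ?P @ u @ ?Q" .
  \<comment> \<open>Substituting the sandwich for \<open>u\<close> puts \<open>s'\<close> next to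
    \<open>?P\<close> and \<open>t'\<close> next to \<open>?Q\<close>, whose bases contain their
    letters.\<close>
  have "v \<approx> s' @ (?P @ u @ ?Q) @ t'"
    using keq_trans[OF vu keq_context[OF sandwich words(3,4)]] .
  also have "\<dots> \<approx> ?P @ u @ ?Q"
    using keq_append[OF pow_word_absorb_word_left[OF pq(1), of s']
        keq_append[OF keq_refl[OF u] pow_word_absorb_word_right[OF pq(2), of t']]]
    by (simp add: p_def q_def)
  also have "\<dots> \<approx> u"
    using sandwich by (rule keq_sym)
  finally show ?thesis by (rule keq_sym)
qed

end

section \<open>Green's relations\<close>

text \<open>Carries \<open>keq_mutual_factors\<close> over to congruence classes by choosing
  representatives.\<close>

lemma Kiselman_mutual_factors:
  fixes n :: nat
  defines "M \<equiv> Kiselman n"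
  assumes carrier: "a \<in> carrier M" "b \<in> carrier M" "s \<in> carrier M" "t \<in> carrier M"
      "s' \<in> carrier M" "t' \<in> carrier M"
    and ab: "a = s \<otimes>\<^bsub>M\<^esub> b \<otimes>\<^bsub>M\<^esub> t" and ba: "b = s' \<otimes>\<^bsub>M\<^esub> a \<otimes>\<^bsub>M\<^esub> t'"
  shows "a = b"
proof -
  let ?E = "pres_cong {1..n} (kiselman_rels n)"
  have rep: "\<exists>u \<in> lists {1..n}. x = ?E `` {u}" if "x \<in> carrier M" for x
    using that by (auto simp: M_def Kiselman_def presented_monoid_def quotient_def)
  obtain u v x y x' y' where
    words: "u \<in> lists {1..n}" "v \<in> lists {1..n}" "x \<in> lists {1..n}" "y \<in> lists {1..n}"
      "x' \<in> lists {1..n}" "y' \<in> lists {1..n}" and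
    reps: "a = ?E `` {u}" "b = ?E `` {v}" "s = ?E `` {x}" "t = ?E `` {y}"
      "s' = ?E `` {x'}" "t' = ?E `` {y'}"
    using carrier[THEN rep] by metis
  have mult: "?E `` {f} \<otimes>\<^bsub>M\<^esub> ?E `` {g} \<otimes>\<^bsub>M\<^esub> ?E `` {h} = ?E `` {f @ g @ h}"
    if "f \<in> lists {1..n}" "g \<in> lists {1..n}" "h \<in> lists {1..n}" for f g h
    using that by (simp add: M_def Kiselman_def presented_monoid_mult_class)
  have eq_iff: "?E `` {f} = ?E `` {g} \<longleftrightarrow> keq n f g"
    if "f \<in> lists {1..n}" "g \<in> lists {1..n}" for f g
    using eq_equiv_class_iff[OF equiv_pres_cong that] by (simp add: keq_def)
  have "?E `` {u} = ?E `` {x @ v @ y}"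
    using ab words(2-4) unfolding reps by (simp only: mult)
  then have "keq n u (x @ v @ y)"
    using words by (simp only: eq_iff append_in_lists_conv)
  moreover have "?E `` {v} = ?E `` {x' @ u @ y'}"
    using ba words(1,5,6) unfolding reps by (simp only: mult)
  then have "keq n v (x' @ u @ y')"
    using words by (simp only: eq_iff append_in_lists_conv)
  ultimately have "keq n u v"
    using words(3-6) by (rule keq_mutual_factors)
  then show ?thesis
    using words by (simp add: reps eq_iff del: One_nat_def)
qed

lemma (in monoid) mem_two_sided_ideal:
  assumes "a \<in> carrier G"
  shows "a \<in> (carrier G #> a) <#> carrier G"
proof -
  have "a = (\<one> \<otimes> a) \<otimes> \<one>" using assms by simp
  then show ?thesis unfolding set_mult_def r_coset_def by blast
qed

lemma green_J_Kiselman_subset: "green_J (Kiselman n) \<subseteq> Id"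
proof clarify
  fix a b assume ab: "(a, b) \<in> green_J (Kiselman n)"
  interpret monoid "Kiselman n" by (rule monoid_Kiselman)
  let ?M = "Kiselman n"
  have carr: "a \<in> carrier ?M" "b \<in> carrier ?M" using ab by (auto simp: green_J_def)
  have "a \<in> (carrier ?M #>\<^bsub>?M\<^esub> b) <#>\<^bsub>?M\<^esub> carrier ?M"
    "b \<in> (carrier ?M #>\<^bsub>?M\<^esub> a) <#>\<^bsub>?M\<^esub> carrier ?M"
    using ab mem_two_sided_ideal carr by (auto simp: green_J_def)
  then obtain s t s' t' where "s \<in> carrier ?M" "t \<in> carrier ?M" "s' \<in> carrier ?M" "t' \<in> carrier ?M"
    "a = s \<otimes>\<^bsub>?M\<^esub> b \<otimes>\<^bsub>?M\<^esub> t" "b = s' \<otimes>\<^bsub>?M\<^esub> a \<otimes>\<^bsub>?M\<^esub> t'"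
    unfolding set_mult_def r_coset_def by blast
  then show "a = b" using Kiselman_mutual_factors carr by blast
qed

lemma (in monoid) green_L_subset_J: "green_L G \<subseteq> green_J G"
  by (auto simp: green_L_def green_J_def)

lemma (in monoid) green_R_subset_J: "green_R G \<subseteq> green_J G"
proof clarify
  fix a b assume ab: "(a, b) \<in> green_R G"
  \<comment> \<open>\<open>green_J\<close> brackets the ideal as \<open>(M x) M\<close>.
    Reassociated to \<open>M (x M)\<close>, it visibly depends on \<open>x\<close> only through the
    right ideal \<open>x M\<close>.\<close>
  have ideal: "(carrier G #> x) <#> carrier G = (\<Union>h \<in> carrier G. h <# (x <# carrier G))"
    if "x \<in> carrier G" for x
    using that by (fastforce simp: set_mult_def r_coset_def l_coset_def m_assoc)
  show "(a, b) \<in> green_J G"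
    using ab by (auto simp: green_R_def green_J_def ideal)
qed

text \<open>Being transitive, \<open>green_J\<close> contains the transitive closure of the union of
  two relations that lie in it.\<close>

lemma (in monoid) green_D_subset_J: "green_D G \<subseteq> green_J G"
proof -
  have "green_D G \<subseteq> (green_J G)\<^sup>+"
    unfolding green_D_def using green_L_subset_J green_R_subset_J by (intro trancl_mono_subset) auto
  also have "\<dots> = green_J G"
    using equiv_green_J by (intro trancl_id) (auto simp: equiv_def)
  finally show ?thesis .
qed

lemma quotient_singleton:
  assumes "equiv A r" "r \<subseteq> Id" "C \<in> A // r"
  shows "is_singleton C"
proof -
  obtain x where "x \<in> A" "C = r `` {x}" using assms(3) by (rule quotientE)
  then have "C = {x}" using assms(2) equiv_class_self[OF assms(1)] by blast
  then show ?thesis by simp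
qed

theorem theorem22:
  fixes n :: nat
  assumes "n \<ge> 1"
  shows "(\<forall>C \<in> carrier (Kiselman n) // green_L (Kiselman n). is_singleton C)
       \<and> (\<forall>C \<in> carrier (Kiselman n) // green_R (Kiselman n). is_singleton C)
       \<and> (\<forall>C \<in> carrier (Kiselman n) // green_D (Kiselman n). is_singleton C)
       \<and> (\<forall>C \<in> carrier (Kiselman n) // green_H (Kiselman n). is_singleton C)
       \<and> (\<forall>C \<in> carrier (Kiselman n) // green_J (Kiselman n). is_singleton C)"
proof -
  interpret monoid "Kiselman n" by (rule monoid_Kiselman)
  \<comment> \<open>The relation \<open>green_J\<close> contains the other four, so its triviality
    decides every case.\<close>
  note J = green_J_Kiselman_subset[of n]
  have L: "green_L (Kiselman n) \<subseteq> Id" using green_L_subset_J J by (rule subset_trans)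
  have R: "green_R (Kiselman n) \<subseteq> Id" using green_R_subset_J J by (rule subset_trans)
  have D: "green_D (Kiselman n) \<subseteq> Id" using green_D_subset_J J by (rule subset_trans)
  have H: "green_H (Kiselman n) \<subseteq> Id" using L by (auto simp: green_H_def)
  show ?thesis
    using quotient_singleton[OF equiv_green_L L] quotient_singleton[OF equiv_green_R R]
      quotient_singleton[OF equiv_green_D D] quotient_singleton[OF equiv_green_H H]
      quotient_singleton[OF equiv_green_J J]
    by blast
qed

end
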